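(* Let $a<b$ be real numbers, let $f:[a,b]\to\mathbb{R}$ be convex and let $N\in\mathbb{N}$. If $0\leq \nu\leq \frac{1}{2}$, then $$f\left((1-\nu)a+\nu b\right)+(1-A_1(\nu))\left(f(a)+f(b)-2f\left(\tfrac{a+b}{2}\right)\right)\geq (1-\nu)f(a)+\nu f(b)+\sum_{j=1}^{N}A_j(1-2\nu)\,\Delta_jf\left(1-2\nu;\tfrac{a+b}{2},b\right).$$ If $\frac{1}{2}\leq\nu\leq 1$, then $$f\left((1-\nu)a+\nu b\right)+(1-A_1(\nu))\left(f(a)+f(b)-2f\left(\tfrac{a+b}{2}\right)\right)\geq (1-\nu)f(a)+\nu f(b)+\sum_{j=1}^{N}A_j(2-2\nu)\,\Delta_jf\left(2-2\nu;a,\tfrac{a+b}{2}\right).$$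
   Context: $\mathbb{N}=\{1,2,3,\dots\}$ and $[\cdot]$ denotes the integer part (floor). For $0\le\mu\le 1$ and $j\in\mathbb{N}$ let $k_j(\mu)=[2^{j-1}\mu]$, $r_j(\mu)=[2^{j}\mu]$ and $$A_j(\mu)=(-1)^{r_j(\mu)}2^{j-1}\mu+(-1)^{r_j(\mu)+1}\left[\frac{r_j(\mu)+1}{2}\right].$$ For reals $c<d$ in $[a,b]$ let $$\Delta_jf(\mu;c,d)=f\left(\left(1-\tfrac{k_j(\mu)}{2^{j-1}}\right)c+\tfrac{k_j(\mu)}{2^{j-1}}d\right)+f\left(\left(1-\tfrac{k_j(\mu)+1}{2^{j-1}}\right)c+\tfrac{k_j(\mu)+1}{2^{j-1}}d\right)-2f\left(\left(1-\tfrac{2k_j(\mu)+1}{2^{j}}\right)c+\tfrac{2k_j(\mu)+1}{2^{j}}d\right),$$ with the convention that $f$ takes the value $0$ at points where it is not defined (points outside $[c,d]$ occur only when $\mu=1$, where $A_j(1)=0$). *)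

theory Defs
  imports "HOL-Analysis.Analysis"
begin

(* The index j ranges over {1, 2, 3, ...}; at j = 0 these definitions carry no meaning. *)

definition dyadic_k :: "nat \<Rightarrow> real \<Rightarrow> int" where
  "dyadic_k j \<mu> = \<lfloor>2 ^ (j - 1) * \<mu>\<rfloor>"

definition dyadic_r :: "nat \<Rightarrow> real \<Rightarrow> int" where
  "dyadic_r j \<mu> = \<lfloor>2 ^ j * \<mu>\<rfloor>"

definition dyadic_A :: "nat \<Rightarrow> real \<Rightarrow> real" where
  "dyadic_A j \<mu> =
     (- 1) powi dyadic_r j \<mu> * 2 ^ (j - 1) * \<mu>
     + (- 1) powi (dyadic_r j \<mu> + 1) * of_int \<lfloor>(of_int (dyadic_r j \<mu>) + 1) / (2 :: real)\<rfloor>"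

(* A function with domain S is a total function here; only its values on S are meaningful.
   ext_zero implements the convention that it takes the value 0 where it is not defined. *)

definition ext_zero :: "real set \<Rightarrow> (real \<Rightarrow> real) \<Rightarrow> real \<Rightarrow> real" where
  "ext_zero S f x = (if x \<in> S then f x else 0)"

definition dyadic_Delta ::
    "real set \<Rightarrow> (real \<Rightarrow> real) \<Rightarrow> nat \<Rightarrow> real \<Rightarrow> real \<Rightarrow> real \<Rightarrow> real" where
  "dyadic_Delta S f j \<mu> c d =
     (let k = of_int (dyadic_k j \<mu>) in
        ext_zero S f ((1 - k / 2 ^ (j - 1)) * c + k / 2 ^ (j - 1) * d)
        + ext_zero S f ((1 - (k + 1) / 2 ^ (j - 1)) * c + (k + 1) / 2 ^ (j - 1) * d)
        - 2 * ext_zero S f ((1 - (2 * k + 1) / 2 ^ j) * c + (2 * k + 1) / 2 ^ j * d))"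

end

theory Submission
  imports Defs
begin

text \<open>
  Let \<open>P\<^sub>n\<close> be the piecewise linear interpolant of \<open>f\<close> at the dyadic points of level \<open>n\<close> of the
  segment from \<open>c\<close> to \<open>d\<close>. Then \<open>A\<^sub>j(\<mu>) \<Delta>\<^sub>j f(\<mu>; c, d)\<close> is the difference of \<open>P\<^sub>j\<^sub>-\<^sub>1\<close> and \<open>P\<^sub>j\<close> at the
  parameter \<open>\<mu>\<close>, so the sum telescopes, and by convexity it is at most
  \<open>(1 - \<mu>) f(c) + \<mu> f(d) - f((1 - \<mu>) c + \<mu> d)\<close>. With this bound on the half of \<open>[a, b]\<close> that contains
  the mirror image \<open>y\<close> of \<open>x = (1 - \<nu>) a + \<nu> b\<close>, the claim reduces to
  \<open>f(x) + f(y) \<ge> 2 f((a + b) / 2)\<close>.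
\<close>

text \<open>The right node is weighted by \<open>frac (2 ^ n * t)\<close>, which is 0 whenever
  \<open>2 ^ n * t\<close> is an integer. So at \<open>t = 1\<close> the value of \<open>g\<close>
  at the node beyond 1 has no effect.\<close>

definition dyadic_interp :: "nat \<Rightarrow> (real \<Rightarrow> real) \<Rightarrow> real \<Rightarrow> real" where
  "dyadic_interp n g t =
     (1 - frac (2 ^ n * t)) * g (of_int \<lfloor>2 ^ n * t\<rfloor> / 2 ^ n)
     + frac (2 ^ n * t) * g ((of_int \<lfloor>2 ^ n * t\<rfloor> + 1) / 2 ^ n)"

lemma dyadic_interp_0:
  assumes "0 \<le> t" "t \<le> 1"
  shows "dyadic_interp 0 g t = (1 - t) * g 0 + t * g 1"
proof (cases "t = 1")
  case True
  then show ?thesis by (simp add: dyadic_interp_def)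
next
  case False
  with assms have "\<lfloor>t\<rfloor> = 0" "frac t = t" by (auto simp: floor_eq_iff frac_eq)
  then show ?thesis by (simp add: dyadic_interp_def)
qed

lemma dyadic_interp_ge:
  assumes g: "convex_on {0..1} g" and t: "0 \<le> t" "t \<le> 1"
  shows "g t \<le> dyadic_interp n g t"
proof -
  define k where "k = \<lfloor>2 ^ n * t\<rfloor>"
  define s where "s = frac (2 ^ n * t)"
  have ks: "2 ^ n * t = of_int k + s" by (simp add: k_def s_def frac_def)
  have s: "0 \<le> s" "s < 1" by (simp_all add: s_def frac_lt_1)
  have k0: "0 \<le> k" using t by (simp add: k_def)
  have tt: "t = (of_int k + s) / 2 ^ n" using ks by (simp add: field_simps)
  show ?thesis
  proof (cases "s = 0")
    case True
    then show ?thesis by (simp add: dyadic_interp_def tt flip: k_def s_def)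
  next
    case False
    \<comment> \<open>Only for \<open>s > 0\<close> is \<open>k\<close> strictly below
      \<open>2 ^ n\<close>; this places the right node in [0, 1], so that convexity applies.\<close>
    have "2 ^ n * t \<le> 2 ^ n" using t by simp
    with ks s False have "real_of_int k < 2 ^ n" by linarith
    then have "k + 1 \<le> 2 ^ n" by simp
    then have "real_of_int (k + 1) \<le> of_int (2 ^ n)" unfolding of_int_le_iff .
    then have k1: "real_of_int k + 1 \<le> 2 ^ n" by simp
    have "g ((1 - s) *\<^sub>R (of_int k / 2 ^ n) + s *\<^sub>R ((of_int k + 1) / 2 ^ n))
          \<le> (1 - s) * g (of_int k / 2 ^ n) + s * g ((of_int k + 1) / 2 ^ n)"
      using s k0 k1 \<open>k + 1 \<le> 2 ^ n\<close> by (intro convex_onD[OF g]) auto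
    moreover have "(1 - s) *\<^sub>R (of_int k / 2 ^ n) + s *\<^sub>R ((of_int k + 1) / 2 ^ n) = t"
      by (simp add: tt field_simps)
    ultimately show ?thesis by (simp add: dyadic_interp_def flip: k_def s_def)
  qed
qed

text \<open>Refining the grid adds the midpoint of the cell containing \<mu>. With \<open>s\<close>
  the relative position in that cell, the two interpolants differ by a hat function,
  \<open>2 * min s (1 - s)\<close> times its midpoint value, which is half the second difference;
  \<open>dyadic_A\<close> is \<open>min s (1 - s)\<close>.\<close>

lemma dyadic_A_Delta:
  fixes S f c d
  defines "g \<equiv> \<lambda>t. ext_zero S f ((1 - t) * c + t * d)"
  shows "dyadic_A (Suc n) \<mu> * dyadic_Delta S f (Suc n) \<mu> c d
         = dyadic_interp n g \<mu> - dyadic_interp (Suc n) g \<mu>"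
proof -
  define k where "k = \<lfloor>2 ^ n * \<mu>\<rfloor>"
  define s where "s = 2 ^ n * \<mu> - of_int k"
  have ks: "2 ^ n * \<mu> = of_int k + s" by (simp add: s_def)
  have s: "0 \<le> s" "s < 1" unfolding s_def k_def by linarith+
  have frac_n: "frac (2 ^ n * \<mu>) = s" by (simp add: s_def k_def frac_def)
  have ks2: "2 ^ Suc n * \<mu> = 2 * of_int k + 2 * s" using ks by simp
  have Delta: "dyadic_Delta S f (Suc n) \<mu> c d
      = g (of_int k / 2 ^ n) + g ((of_int k + 1) / 2 ^ n) - 2 * g ((2 * of_int k + 1) / 2 ^ Suc n)"
    by (simp add: dyadic_Delta_def dyadic_k_def g_def k_def Let_def)
  have P: "dyadic_interp n g \<mu> = (1 - s) * g (of_int k / 2 ^ n) + s * g ((of_int k + 1) / 2 ^ n)"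
    by (simp add: dyadic_interp_def frac_n flip: k_def)
  show ?thesis
  proof (cases "s < 1 / 2")
    \<comment> \<open>Left half of the cell: the finer cell keeps the left endpoint and has relative
      position \<open>2 * s\<close>.\<close>
    case True
    have r: "\<lfloor>2 ^ Suc n * \<mu>\<rfloor> = 2 * k" unfolding ks2 floor_eq_iff using s True by simp
    have half: "\<lfloor>(of_int (2 * k) + 1) / (2 :: real)\<rfloor> = k" by (simp add: floor_eq_iff field_simps)
    have fr: "frac (2 ^ Suc n * \<mu>) = 2 * s" unfolding frac_def r unfolding ks2 by simp
    have A: "dyadic_A (Suc n) \<mu> = s"
      unfolding dyadic_A_def dyadic_r_def r half using ks by (simp add: power_int_add)
    have e: "real_of_int (2 * k) / 2 ^ Suc n = of_int k / 2 ^ n" by simp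
    have "dyadic_interp (Suc n) g \<mu>
        = (1 - 2 * s) * g (of_int k / 2 ^ n) + 2 * s * g ((2 * of_int k + 1) / 2 ^ Suc n)"
      unfolding dyadic_interp_def fr r e by simp
    then show ?thesis by (simp add: A Delta P algebra_simps)
  next
    \<comment> \<open>Right half: the finer cell keeps the right endpoint and has relative position
      \<open>2 * s - 1\<close>. The odd exponent flips both signs in
      \<open>dyadic_A\<close>.\<close>
    case False
    have r: "\<lfloor>2 ^ Suc n * \<mu>\<rfloor> = 2 * k + 1" unfolding ks2 floor_eq_iff using s False by simp
    have half: "\<lfloor>(of_int (2 * k + 1) + 1) / (2 :: real)\<rfloor> = k + 1"
      by (simp add: floor_eq_iff field_simps)
    have fr: "frac (2 ^ Suc n * \<mu>) = 2 * s - 1" unfolding frac_def r unfolding ks2 by simp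
    have A: "dyadic_A (Suc n) \<mu> = 1 - s"
      unfolding dyadic_A_def dyadic_r_def r half using ks by (simp add: power_int_add)
    have e: "(real_of_int (2 * k + 1) + 1) / 2 ^ Suc n = (of_int k + 1) / 2 ^ n"
      by (simp add: field_simps)
    have "dyadic_interp (Suc n) g \<mu>
        = (2 - 2 * s) * g ((2 * of_int k + 1) / 2 ^ Suc n) + (2 * s - 1) * g ((of_int k + 1) / 2 ^ n)"
      unfolding dyadic_interp_def fr r e by simp
    then show ?thesis by (simp add: A Delta P algebra_simps)
  qed
qed

text \<open>The segment from \<open>c\<close> to \<open>d\<close> stays in the convex set
  \<open>S\<close>, so \<open>f\<close> pulls back along its affine parametrization to a convex
  \<open>g\<close> on [0, 1], unaffected there by the default value 0.\<close>

lemma sum_dyadic_A_Delta_le: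
  assumes f: "convex_on S f" and S: "c \<in> S" "d \<in> S" and \<mu>: "0 \<le> \<mu>" "\<mu> \<le> 1"
  shows "(\<Sum>j = 1..N. dyadic_A j \<mu> * dyadic_Delta S f j \<mu> c d)
         \<le> (1 - \<mu>) * f c + \<mu> * f d - f ((1 - \<mu>) * c + \<mu> * d)"
proof -
  define g where "g = (\<lambda>t. ext_zero S f ((1 - t) * c + t * d))"
  have in_S: "(1 - t) * c + t * d \<in> S" if "0 \<le> t" "t \<le> 1" for t
    using convexD_alt[OF convex_on_imp_convex[OF f] S, of t] that by simp
  have g_eq: "g t = f ((1 - t) * c + t * d)" if "0 \<le> t" "t \<le> 1" for t
    using in_S[OF that] by (simp add: g_def ext_zero_def)
  have g: "convex_on {0..1} g"
  proof (rule convex_onI)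
    fix t x y :: real
    assume t: "0 < t" "t < 1" and xy: "x \<in> {0..1}" "y \<in> {0..1}"
    have z: "(1 - t) *\<^sub>R x + t *\<^sub>R y \<in> {0..1}"
      using convexD_alt[of "{0..1::real}" x y t] t xy by simp
    have "g ((1 - t) *\<^sub>R x + t *\<^sub>R y)
        = f ((1 - t) *\<^sub>R ((1 - x) * c + x * d) + t *\<^sub>R ((1 - y) * c + y * d))"
      using z by (simp add: g_eq) (simp add: algebra_simps)
    also have "\<dots> \<le> (1 - t) * f ((1 - x) * c + x * d) + t * f ((1 - y) * c + y * d)"
      using t xy by (intro convex_onD[OF f] in_S) auto
    finally show "g ((1 - t) *\<^sub>R x + t *\<^sub>R y) \<le> (1 - t) * g x + t * g y"
      using xy by (simp add: g_eq)
  qed auto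
  have "(\<Sum>j = 1..N. dyadic_A j \<mu> * dyadic_Delta S f j \<mu> c d)
      = (\<Sum>n<N. dyadic_A (Suc n) \<mu> * dyadic_Delta S f (Suc n) \<mu> c d)"
    by (simp add: sum.atLeast1_atMost_eq)
  also have "\<dots> = (\<Sum>n<N. dyadic_interp n g \<mu> - dyadic_interp (Suc n) g \<mu>)"
    by (simp only: dyadic_A_Delta g_def)
  also have "\<dots> = dyadic_interp 0 g \<mu> - dyadic_interp N g \<mu>"
    by (rule sum_lessThan_telescope')
  \<comment> \<open>The interpolant of level 0 is the chord, and the one of level \<open>N\<close>
    lies above \<open>g\<close>.\<close>
  also have "\<dots> \<le> (1 - \<mu>) * g 0 + \<mu> * g 1 - g \<mu>"
    using dyadic_interp_ge[OF g \<mu>] by (simp add: dyadic_interp_0[OF \<mu>])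
  finally show ?thesis using \<mu> by (simp add: g_eq)
qed

lemma dyadic_A_1:
  assumes "0 \<le> \<nu>" "\<nu> \<le> 1"
  shows "dyadic_A 1 \<nu> = min \<nu> (1 - \<nu>)"
proof -
  \<comment> \<open>The cases are the values 0, 1 and 2 of the floor of \<open>2 * \<nu>\<close>;
    the last occurs only at the endpoint.\<close>
  consider "\<nu> < 1 / 2" | "1 / 2 \<le> \<nu>" "\<nu> < 1" | "\<nu> = 1" using assms by linarith
  then show ?thesis
  proof cases
    case 1
    then have "\<lfloor>2 * \<nu>\<rfloor> = 0" using assms by (simp add: floor_eq_iff)
    with 1 show ?thesis by (simp add: dyadic_A_def dyadic_r_def)
  next
    case 2
    then have "\<lfloor>2 * \<nu>\<rfloor> = 1" by (simp add: floor_eq_iff)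
    with 2 show ?thesis by (simp add: dyadic_A_def dyadic_r_def)
  next
    case 3
    have "\<lfloor>3 / 2 :: real\<rfloor> = 1" by (simp add: floor_eq_iff)
    with 3 show ?thesis by (simp add: dyadic_A_def dyadic_r_def)
  qed
qed

theorem theorem2p7:
  fixes a b \<nu> :: real and f :: "real \<Rightarrow> real" and N :: nat
  assumes "a < b" and "convex_on {a..b} f" and "1 \<le> N"
  shows
    "(0 \<le> \<nu> \<and> \<nu> \<le> 1 / 2 \<longrightarrow>
       f ((1 - \<nu>) * a + \<nu> * b) + (1 - dyadic_A 1 \<nu>) * (f a + f b - 2 * f ((a + b) / 2))
       \<ge> (1 - \<nu>) * f a + \<nu> * f b
         + (\<Sum>j = 1..N. dyadic_A j (1 - 2 * \<nu>)
              * dyadic_Delta {a..b} f j (1 - 2 * \<nu>) ((a + b) / 2) b))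
     \<and>
     (1 / 2 \<le> \<nu> \<and> \<nu> \<le> 1 \<longrightarrow>
       f ((1 - \<nu>) * a + \<nu> * b) + (1 - dyadic_A 1 \<nu>) * (f a + f b - 2 * f ((a + b) / 2))
       \<ge> (1 - \<nu>) * f a + \<nu> * f b
         + (\<Sum>j = 1..N. dyadic_A j (2 - 2 * \<nu>)
              * dyadic_Delta {a..b} f j (2 - 2 * \<nu>) a ((a + b) / 2)))"
proof (intro conjI impI)
  define m where "m = (a + b) / 2"
  have S: "a \<in> {a..b}" "b \<in> {a..b}" "m \<in> {a..b}" using \<open>a < b\<close> by (auto simp: m_def)
  \<comment> \<open>The point \<open>m\<close> is the midpoint of the two mirror points.\<close>
  have mirror: "2 * f m \<le> f ((1 - \<nu>) * a + \<nu> * b) + f (\<nu> * a + (1 - \<nu>) * b)"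
    if "0 \<le> \<nu>" "\<nu> \<le> 1"
  proof -
    have "(1 - \<nu>) * a + \<nu> * b \<in> {a..b}" "\<nu> * a + (1 - \<nu>) * b \<in> {a..b}"
      using convexD_alt[of "{a..b}" a b \<nu>] convexD_alt[of "{a..b}" b a \<nu>] S that
      by (simp_all add: add.commute)
    from convex_onD[OF assms(2) _ _ this, of "1 / 2"]
    have "f ((1 - 1 / 2) *\<^sub>R ((1 - \<nu>) * a + \<nu> * b) + (1 / 2) *\<^sub>R (\<nu> * a + (1 - \<nu>) * b))
        \<le> (1 - 1 / 2) * f ((1 - \<nu>) * a + \<nu> * b) + 1 / 2 * f (\<nu> * a + (1 - \<nu>) * b)"
      by simp
    moreover have "(1 - 1 / 2) *\<^sub>R ((1 - \<nu>) * a + \<nu> * b) + (1 / 2) *\<^sub>R (\<nu> * a + (1 - \<nu>) * b) = m"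
      by (simp add: m_def field_simps)
    ultimately show ?thesis by simp
  qed
  {
    assume \<nu>: "0 \<le> \<nu> \<and> \<nu> \<le> 1 / 2"
    \<comment> \<open>The mirror point lies in the right half, and \<open>1 - 2 * \<nu>\<close> is
      its parameter from \<open>m\<close> to \<open>b\<close>.\<close>
    have y: "(1 - (1 - 2 * \<nu>)) * m + (1 - 2 * \<nu>) * b = \<nu> * a + (1 - \<nu>) * b"
      by (simp add: m_def field_simps)
    have A: "dyadic_A 1 \<nu> = \<nu>" using dyadic_A_1[of \<nu>] \<nu> by simp
    have "(\<Sum>j = 1..N. dyadic_A j (1 - 2 * \<nu>) * dyadic_Delta {a..b} f j (1 - 2 * \<nu>) m b)
        \<le> (1 - (1 - 2 * \<nu>)) * f m + (1 - 2 * \<nu>) * f b - f (\<nu> * a + (1 - \<nu>) * b)"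
      using sum_dyadic_A_Delta_le[OF assms(2) S(3) S(2), of "1 - 2 * \<nu>" N] \<nu> unfolding y by simp
    \<comment> \<open>After inserting the bound on the sum, all terms in \<open>f a\<close> and
      \<open>f b\<close> cancel and those in \<open>f m\<close> add up to \<open>- 2 * f m\<close>,
      which leaves \<open>mirror\<close>.\<close>
    with mirror \<nu> show "f ((1 - \<nu>) * a + \<nu> * b) + (1 - dyadic_A 1 \<nu>) * (f a + f b - 2 * f ((a + b) / 2))
        \<ge> (1 - \<nu>) * f a + \<nu> * f b
          + (\<Sum>j = 1..N. dyadic_A j (1 - 2 * \<nu>)
               * dyadic_Delta {a..b} f j (1 - 2 * \<nu>) ((a + b) / 2) b)"
      unfolding A by (fold m_def) (simp add: algebra_simps)
  next
    assume \<nu>: "1 / 2 \<le> \<nu> \<and> \<nu> \<le> 1"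
    \<comment> \<open>Now the mirror point lies in the left half, with parameter
      \<open>2 - 2 * \<nu>\<close> from \<open>a\<close> to \<open>m\<close>.\<close>
    have y: "(1 - (2 - 2 * \<nu>)) * a + (2 - 2 * \<nu>) * m = \<nu> * a + (1 - \<nu>) * b"
      by (simp add: m_def field_simps)
    have A: "dyadic_A 1 \<nu> = 1 - \<nu>" using dyadic_A_1[of \<nu>] \<nu> by simp
    have "(\<Sum>j = 1..N. dyadic_A j (2 - 2 * \<nu>) * dyadic_Delta {a..b} f j (2 - 2 * \<nu>) a m)
        \<le> (1 - (2 - 2 * \<nu>)) * f a + (2 - 2 * \<nu>) * f m - f (\<nu> * a + (1 - \<nu>) * b)"
      using sum_dyadic_A_Delta_le[OF assms(2) S(1) S(3), of "2 - 2 * \<nu>" N] \<nu> unfolding y by simp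
    with mirror \<nu> show "f ((1 - \<nu>) * a + \<nu> * b) + (1 - dyadic_A 1 \<nu>) * (f a + f b - 2 * f ((a + b) / 2))
        \<ge> (1 - \<nu>) * f a + \<nu> * f b
          + (\<Sum>j = 1..N. dyadic_A j (2 - 2 * \<nu>)
               * dyadic_Delta {a..b} f j (2 - 2 * \<nu>) a ((a + b) / 2))"
      unfolding A by (fold m_def) (simp add: algebra_simps)
  }
qed

end
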